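(* Let $\mathfrak{g}$ be an $n$-dimensional Lie algebra over $\mathbb{K}$ ($\mathbb{K}=\mathbb{R}$ or $\mathbb{C}$) with ordered basis $X_1,\dots,X_n$ and structure constants $C_{\mu\nu\alpha}$, $[X_\mu,X_\nu]=\sum_{\alpha=1}^n C_{\mu\nu\alpha}X_\alpha$. Let $\mathfrak{g}^R$ be the Lie algebra with basis $\{X_\mu,T^{-1}_{\mu\nu}\mid 1\le\mu,\nu\le n\}$ defined by the relations $$[X_\mu,X_\nu]=\sum_{\alpha=1}^n C_{\mu\nu\alpha}X_\alpha,\qquad [T^{-1}_{\alpha\beta},T^{-1}_{\mu\nu}]=0,\qquad [T^{-1}_{\mu\nu},X_\lambda]=\sum_{\alpha=1}^n C_{\lambda\alpha\nu}\,T^{-1}_{\mu\alpha}.$$ Then there exists a left action $\blacktriangleright\colon U(\mathfrak{g}^R)\otimes U(\mathfrak{g})\to U(\mathfrak{g})$ satisfying $$1\blacktriangleright X=X,\qquad X_\mu\blacktriangleright X=X_\mu X,$$ $$T^{-1}_{\mu\nu}\blacktriangleright 1=\delta_{\mu\nu},\qquad T^{-1}_{\mu\nu}\blacktriangleright(XY)=\sum_{\alpha=1}^n (T^{-1}_{\alpha\nu}\blacktriangleright X)\,(T^{-1}_{\mu\alpha}\blacktriangleright Y)$$ for all $X,Y\in U(\mathfrak{g})$ and $1\le\mu,\nu\le n$.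
   Context: $U(\cdot)$ denotes the universal enveloping algebra. Here $T^{-1}_{\mu\nu}$ is just a symbol for a basis element of $\mathfrak{g}^R$ (no inverse is being taken). $\delta_{\mu\nu}$ is the Kronecker delta (times the unit of $U(\mathfrak{g})$). A left action is a linear map with $(ab)\blacktriangleright X=a\blacktriangleright(b\blacktriangleright X)$ and $1\blacktriangleright X=X$. *)

theory Defs
  imports Complex_Main "HOL-Algebra.QuotRing" "HOL-Algebra.Module" "HOL-Library.Poly_Mapping"
begin

section \<open>Lie algebras\<close>

locale lie_algebra = vector_space scale
  for scale :: "'k::field \<Rightarrow> 'g::ab_group_add \<Rightarrow> 'g" +
  fixes bracket :: "'g \<Rightarrow> 'g \<Rightarrow> 'g"
  assumes bracket_add_left: "bracket (x + y) z = bracket x z + bracket y z"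
    and bracket_add_right: "bracket x (y + z) = bracket x y + bracket x z"
    and bracket_scale_left: "bracket (scale c x) y = scale c (bracket x y)"
    and bracket_scale_right: "bracket x (scale c y) = scale c (bracket x y)"
    and bracket_self: "bracket x x = 0"
    and jacobi: "bracket x (bracket y z) + bracket y (bracket z x) + bracket z (bracket x y) = 0"

context vector_space
begin

definition basis_family :: "'i set \<Rightarrow> ('i \<Rightarrow> 'b) \<Rightarrow> bool"
  where "basis_family I b \<longleftrightarrow> inj_on b I \<and> independent (b ` I) \<and> span (b ` I) = UNIV"

end

text \<open>
  Every basis family with the required index set carries a bracket defined by the relations of the
  extended Lie algebra, so postulating these relations is no restriction. A commutative field of
  class \<^class>\<open>real_normed_field\<close> has a multiplicative norm over the reals and is therefore
  isomorphic to the field of real or of complex numbers (Gelfand--Mazur); this class stands for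
  these two ground fields.
\<close>

lemma extended_bracket_exists:
  fixes scale :: "'k::real_normed_field \<Rightarrow> 'g::ab_group_add \<Rightarrow> 'g"
    and scaleR :: "'k \<Rightarrow> 'h::ab_group_add \<Rightarrow> 'h"
    and C :: "nat \<Rightarrow> nat \<Rightarrow> nat \<Rightarrow> 'k"
  assumes lie: "lie_algebra scale bracket"
    and basis: "vector_space.basis_family scale {1..n} X"
    and C: "\<forall>\<mu>\<in>{1..n}. \<forall>\<nu>\<in>{1..n}.
      bracket (X \<mu>) (X \<nu>) = (\<Sum>\<alpha>=1..n. scale (C \<mu> \<nu> \<alpha>) (X \<alpha>))"
    and vs: "vector_space scaleR"
    and basisR: "vector_space.basis_family scaleR (Inl ` {1..n} \<union> Inr ` ({1..n} \<times> {1..n}))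
      (case_sum XR (\<lambda>(\<mu>, \<nu>). Tinv \<mu> \<nu>))"
  shows "\<exists>bracketR. lie_algebra scaleR bracketR \<and>
    (\<forall>\<mu>\<in>{1..n}. \<forall>\<nu>\<in>{1..n}.
      bracketR (XR \<mu>) (XR \<nu>) = (\<Sum>\<alpha>=1..n. scaleR (C \<mu> \<nu> \<alpha>) (XR \<alpha>))) \<and>
    (\<forall>\<alpha>\<in>{1..n}. \<forall>\<beta>\<in>{1..n}. \<forall>\<mu>\<in>{1..n}. \<forall>\<nu>\<in>{1..n}.
      bracketR (Tinv \<alpha> \<beta>) (Tinv \<mu> \<nu>) = 0) \<and>
    (\<forall>\<mu>\<in>{1..n}. \<forall>\<nu>\<in>{1..n}. \<forall>\<kappa>\<in>{1..n}.
      bracketR (Tinv \<mu> \<nu>) (XR \<kappa>) = (\<Sum>\<alpha>=1..n. scaleR (C \<kappa> \<alpha> \<nu>) (Tinv \<mu> \<alpha>)))"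
proof -
  interpret g: lie_algebra scale bracket by fact
  interpret h: vector_space scaleR by fact
  define N where "N = {1..n}"
  have finN [simp]: "finite N" by (simp add: N_def)
  note C = C[folded N_def] and basis = basis[folded N_def] and basisR = basisR[folded N_def]
  have indep: "c \<nu> = 0" if "(\<Sum>\<alpha>\<in>N. scale (c \<alpha>) (X \<alpha>)) = 0" "\<nu> \<in> N" for c \<nu>
  proof -
    have inj: "inj_on X N" and ind: "g.independent (X ` N)"
      using basis by (auto simp: g.basis_family_def)
    have "(\<Sum>v\<in>X ` N. scale (c (inv_into N X v)) v) = (\<Sum>\<alpha>\<in>N. scale (c \<alpha>) (X \<alpha>))"
      using inj by (simp add: sum.reindex)
    then have "c (inv_into N X (X \<nu>)) = 0"
      using ind that by (intro g.independentD[OF ind, of "X ` N" "\<lambda>v. c (inv_into N X v)"]) auto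
    then show ?thesis using inj that by simp
  qed
  have bsum: "bracket x (\<Sum>\<alpha>\<in>N. scale (c \<alpha>) (X \<alpha>)) = (\<Sum>\<alpha>\<in>N. scale (c \<alpha>) (bracket x (X \<alpha>)))"
    for x c
  proof -
    have z: "bracket x 0 = 0" using g.bracket_add_right[of x 0 0] by simp
    have "bracket x (sum f A) = (\<Sum>\<alpha>\<in>A. bracket x (f \<alpha>))" if "finite A" for A :: "nat set" and f
      using that by (induction A) (auto simp: z g.bracket_add_right)
    then show ?thesis by (simp add: g.bracket_scale_right)
  qed
  have Canti: "C \<mu> \<nu> \<alpha> = - C \<nu> \<mu> \<alpha>" if "\<mu> \<in> N" "\<nu> \<in> N" "\<alpha> \<in> N" for \<mu> \<nu> \<alpha>
  proof -
    have "bracket (X \<mu> + X \<nu>) (X \<mu> + X \<nu>) = 0" by (rule g.bracket_self)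
    then have "bracket (X \<mu>) (X \<nu>) + bracket (X \<nu>) (X \<mu>) = 0"
      unfolding g.bracket_add_left g.bracket_add_right
      by (simp add: g.bracket_self add.commute)
    then have "(\<Sum>\<alpha>\<in>N. scale (C \<mu> \<nu> \<alpha> + C \<nu> \<mu> \<alpha>) (X \<alpha>)) = 0"
      using C that by (simp add: g.scale_left_distrib sum.distrib)
    from indep[OF this that(3)] show ?thesis by (simp add: eq_neg_iff_add_eq_0)
  qed
  have Cbr: "bracket (X \<kappa>) (bracket (X \<mu>) (X \<nu>)) =
      (\<Sum>\<beta>\<in>N. scale (\<Sum>\<alpha>\<in>N. C \<mu> \<nu> \<alpha> * C \<kappa> \<alpha> \<beta>) (X \<beta>))"
    if "\<kappa> \<in> N" "\<mu> \<in> N" "\<nu> \<in> N" for \<kappa> \<mu> \<nu>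
  proof -
    have "bracket (X \<kappa>) (bracket (X \<mu>) (X \<nu>)) =
        (\<Sum>\<alpha>\<in>N. scale (C \<mu> \<nu> \<alpha>) (\<Sum>\<beta>\<in>N. scale (C \<kappa> \<alpha> \<beta>) (X \<beta>)))"
      using C that by (simp add: bsum)
    also have "\<dots> = (\<Sum>\<alpha>\<in>N. \<Sum>\<beta>\<in>N. scale (C \<mu> \<nu> \<alpha> * C \<kappa> \<alpha> \<beta>) (X \<beta>))"
      by (simp add: g.scale_sum_right)
    also have "\<dots> = (\<Sum>\<beta>\<in>N. \<Sum>\<alpha>\<in>N. scale (C \<mu> \<nu> \<alpha> * C \<kappa> \<alpha> \<beta>) (X \<beta>))"
      by (rule sum.swap)
    finally show ?thesis by (simp add: g.scale_sum_left)
  qed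
  have Cjac: "(\<Sum>\<alpha>\<in>N. C \<mu> \<nu> \<alpha> * C \<kappa> \<alpha> \<beta>) + (\<Sum>\<alpha>\<in>N. C \<nu> \<kappa> \<alpha> * C \<mu> \<alpha> \<beta>)
      + (\<Sum>\<alpha>\<in>N. C \<kappa> \<mu> \<alpha> * C \<nu> \<alpha> \<beta>) = 0"
    if "\<kappa> \<in> N" "\<mu> \<in> N" "\<nu> \<in> N" "\<beta> \<in> N" for \<kappa> \<mu> \<nu> \<beta>
  proof (rule indep[OF _ that(4)])
    show "(\<Sum>\<beta>\<in>N. scale ((\<Sum>\<alpha>\<in>N. C \<mu> \<nu> \<alpha> * C \<kappa> \<alpha> \<beta>) + (\<Sum>\<alpha>\<in>N. C \<nu> \<kappa> \<alpha> * C \<mu> \<alpha> \<beta>)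
      + (\<Sum>\<alpha>\<in>N. C \<kappa> \<mu> \<alpha> * C \<nu> \<alpha> \<beta>)) (X \<beta>)) = 0"
      using g.jacobi[of "X \<kappa>" "X \<mu>" "X \<nu>"] that
      by (simp add: Cbr g.scale_left_distrib sum.distrib)
  qed
  define I where "I = Inl ` N \<union> Inr ` (N \<times> N)"
  define b where "b = case_sum XR (\<lambda>(\<mu>, \<nu>). Tinv \<mu> \<nu>)"
  define B where "B = (\<lambda>i j. case i of
      Inl \<mu> \<Rightarrow> (case j of Inl \<nu> \<Rightarrow> (\<Sum>\<alpha>\<in>N. scaleR (C \<mu> \<nu> \<alpha>) (XR \<alpha>))
        | Inr (\<rho>, \<nu>) \<Rightarrow> - (\<Sum>\<alpha>\<in>N. scaleR (C \<mu> \<alpha> \<nu>) (Tinv \<rho> \<alpha>)))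
    | Inr (\<rho>, \<nu>) \<Rightarrow> (case j of Inl \<mu> \<Rightarrow> (\<Sum>\<alpha>\<in>N. scaleR (C \<mu> \<alpha> \<nu>) (Tinv \<rho> \<alpha>))
        | Inr _ \<Rightarrow> 0))"
  define co where "co = (\<lambda>v i. h.representation (b ` I) v (b i))"
  define br where "br = (\<lambda>u v. \<Sum>i\<in>I. \<Sum>j\<in>I. scaleR (co u i * co v j) (B i j))"
  have inj: "inj_on b I" and ind: "h.independent (b ` I)" and sp: "h.span (b ` I) = UNIV"
    using basisR by (auto simp: h.basis_family_def I_def b_def)
  have finI: "finite I" by (simp add: I_def)
  have co_add: "co (u + v) i = co u i + co v i" for u v i
    by (simp add: co_def h.representation_add[OF ind] sp)
  have co_scale: "co (scaleR c v) i = c * co v i" for c v i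
    by (simp add: co_def h.representation_scale[OF ind] sp)
  have co_b: "co (b j) i = (if i = j then 1 else 0)" if "i \<in> I" "j \<in> I" for i j
    using that inj by (auto simp: co_def h.representation_basis[OF ind] inj_on_def)
  have br_add1: "br (u + v) w = br u w + br v w" for u v w
    by (simp add: br_def co_add algebra_simps h.scale_left_distrib sum.distrib)
  have br_add2: "br w (u + v) = br w u + br w v" for u v w
    by (simp add: br_def co_add algebra_simps h.scale_left_distrib sum.distrib)
  have br_scale1: "br (scaleR c u) w = scaleR c (br u w)" for c u w
    by (simp add: br_def co_scale h.scale_sum_right mult.assoc)
  have br_scale2: "br w (scaleR c u) = scaleR c (br w u)" for c u w
    by (simp add: br_def co_scale h.scale_sum_right mult.left_commute)
  have br_0: "br u 0 = 0" "br 0 u = 0" for u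
    using br_add2[of u 0 0] br_add1[of 0 0 u] by simp_all
  have br_minus: "br u (- v) = - br u v" for u v
    using br_add2[of u v "- v"] by (simp add: br_0 eq_neg_iff_add_eq_0 add.commute)
  have br_sum: "br u (sum f A) = (\<Sum>x\<in>A. br u (f x))" if "finite A" for u f and A :: "nat set"
    using that by (induction A) (auto simp: br_0 br_add2)
  have br_b: "br (b i) (b j) = B i j" if "i \<in> I" "j \<in> I" for i j
  proof -
    have "br (b i) (b j) = (\<Sum>i'\<in>I. \<Sum>j'\<in>I. if j' = j then (if i' = i then B i j else 0) else 0)"
      unfolding br_def using that by (intro sum.cong refl) (auto simp: co_b)
    then show ?thesis using that finI by simp
  qed
  have vanish: "f v = 0" if add: "\<And>x y. f (x + y) = f x + f y"
    and sc: "\<And>c x. f (scaleR c x) = scaleR c (f x)" and z: "\<And>i. i \<in> I \<Longrightarrow> f (b i) = 0"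
    for f :: "'h \<Rightarrow> 'h" and v
  proof -
    have "f 0 = 0" using add[of 0 0] by simp
    then have "h.subspace {x. f x = 0}" by (auto simp: h.subspace_def add sc)
    moreover have "b ` I \<subseteq> {x. f x = 0}" using z by auto
    ultimately have "h.span (b ` I) \<subseteq> {x. f x = 0}" by (rule h.span_minimal[rotated])
    then show ?thesis using sp by auto
  qed
  have B_anti: "B i j + B j i = 0" if "i \<in> I" "j \<in> I" for i j
  proof -
    have "(\<Sum>\<alpha>\<in>N. scaleR (C \<mu> \<nu> \<alpha>) (XR \<alpha>)) + (\<Sum>\<alpha>\<in>N. scaleR (C \<nu> \<mu> \<alpha>) (XR \<alpha>)) = 0"
      if "\<mu> \<in> N" "\<nu> \<in> N" for \<mu> \<nu>
      unfolding sum.distrib[symmetric] h.scale_left_distrib[symmetric]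
    proof (rule sum.neutral, rule ballI)
      fix \<alpha> assume "\<alpha> \<in> N"
      then show "scaleR (C \<mu> \<nu> \<alpha> + C \<nu> \<mu> \<alpha>) (XR \<alpha>) = 0"
        using Canti[of \<mu> \<nu> \<alpha>] that by simp
    qed
    then show ?thesis using that by (auto simp: I_def B_def)
  qed
  have anti: "br u v + br v u = 0" for u v
  proof (rule vanish[of "\<lambda>u. br u v + br v u"])
    fix i assume i: "i \<in> I"
    show "br (b i) v + br v (b i) = 0"
      by (rule vanish[of "\<lambda>v. br (b i) v + br v (b i)"])
        (auto simp: br_add1 br_add2 br_scale1 br_scale2 h.scale_right_distrib br_b B_anti i)
  qed (auto simp: br_add1 br_add2 br_scale1 br_scale2 h.scale_right_distrib)
  have br_self: "br u u = 0" for u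
  proof -
    have "scaleR 2 (br u u) = 0"
      using anti[of u u] h.scale_left_distrib[of 1 1 "br u u"] by simp
    then show ?thesis by simp
  qed
  define J where "J = (\<lambda>u v w. br u (br v w) + br v (br w u) + br w (br u v))"
  have J_cyc: "J u v w = J v w u" for u v w
    by (simp add: J_def ac_simps)
  have J_add: "J (u + u') v w = J u v w + J u' v w" for u u' v w
    by (simp add: J_def br_add1 br_add2 ac_simps)
  have J_scale: "J (scaleR c u) v w = scaleR c (J u v w)" for c u v w
    by (simp add: J_def br_scale1 br_scale2 h.scale_right_distrib)
  have bX: "br (XR \<mu>) (XR \<nu>) = (\<Sum>\<alpha>\<in>N. scaleR (C \<mu> \<nu> \<alpha>) (XR \<alpha>))"
    if "\<mu> \<in> N" "\<nu> \<in> N" for \<mu> \<nu>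
    using br_b[of "Inl \<mu>" "Inl \<nu>"] that by (simp add: b_def B_def I_def)
  have bXT: "br (XR \<mu>) (Tinv \<rho> \<nu>) = - (\<Sum>\<alpha>\<in>N. scaleR (C \<mu> \<alpha> \<nu>) (Tinv \<rho> \<alpha>))"
    if "\<mu> \<in> N" "\<nu> \<in> N" "\<rho> \<in> N" for \<mu> \<nu> \<rho>
    using br_b[of "Inl \<mu>" "Inr (\<rho>, \<nu>)"] that by (simp add: b_def B_def I_def)
  have bTX: "br (Tinv \<rho> \<nu>) (XR \<mu>) = (\<Sum>\<alpha>\<in>N. scaleR (C \<mu> \<alpha> \<nu>) (Tinv \<rho> \<alpha>))"
    if "\<mu> \<in> N" "\<nu> \<in> N" "\<rho> \<in> N" for \<mu> \<nu> \<rho>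
    using br_b[of "Inr (\<rho>, \<nu>)" "Inl \<mu>"] that by (simp add: b_def B_def I_def)
  have bTT: "br (Tinv \<rho> \<nu>) (Tinv \<sigma> \<mu>) = 0"
    if "\<mu> \<in> N" "\<nu> \<in> N" "\<rho> \<in> N" "\<sigma> \<in> N" for \<mu> \<nu> \<rho> \<sigma>
    using br_b[of "Inr (\<rho>, \<nu>)" "Inr (\<sigma>, \<mu>)"] that by (simp add: b_def B_def I_def)
  have collect: "(\<Sum>\<alpha>\<in>N. scaleR (c \<alpha>) (\<Sum>\<beta>\<in>N. scaleR (e \<alpha> \<beta>) (f \<beta>))) =
      (\<Sum>\<beta>\<in>N. scaleR (\<Sum>\<alpha>\<in>N. c \<alpha> * e \<alpha> \<beta>) (f \<beta>))" for c :: "nat \<Rightarrow> 'k" and e f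
  proof -
    have "(\<Sum>\<alpha>\<in>N. scaleR (c \<alpha>) (\<Sum>\<beta>\<in>N. scaleR (e \<alpha> \<beta>) (f \<beta>))) =
        (\<Sum>\<alpha>\<in>N. \<Sum>\<beta>\<in>N. scaleR (c \<alpha> * e \<alpha> \<beta>) (f \<beta>))"
      by (simp add: h.scale_sum_right)
    also have "\<dots> = (\<Sum>\<beta>\<in>N. \<Sum>\<alpha>\<in>N. scaleR (c \<alpha> * e \<alpha> \<beta>) (f \<beta>))" by (rule sum.swap)
    finally show ?thesis by (simp add: h.scale_sum_left)
  qed
  have null: "(\<Sum>\<beta>\<in>N. scaleR (a \<beta>) (f \<beta>)) + (\<Sum>\<beta>\<in>N. scaleR (b \<beta>) (f \<beta>)) +
      (\<Sum>\<beta>\<in>N. scaleR (c \<beta>) (f \<beta>)) = 0"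
    if "\<And>\<beta>. \<beta> \<in> N \<Longrightarrow> a \<beta> + b \<beta> + c \<beta> = 0" for a b c and f :: "nat \<Rightarrow> 'h"
  proof -
    have "(\<Sum>\<beta>\<in>N. scaleR (a \<beta> + b \<beta> + c \<beta>) (f \<beta>)) = 0"
      using that by simp
    then show ?thesis by (simp add: h.scale_left_distrib sum.distrib)
  qed
  have JXXX: "J (XR \<kappa>) (XR \<mu>) (XR \<nu>) = 0" if N: "\<kappa> \<in> N" "\<mu> \<in> N" "\<nu> \<in> N" for \<kappa> \<mu> \<nu>
  proof -
    have *: "br (XR \<kappa>) (br (XR \<mu>) (XR \<nu>)) = (\<Sum>\<beta>\<in>N. scaleR (\<Sum>\<alpha>\<in>N. C \<mu> \<nu> \<alpha> * C \<kappa> \<alpha> \<beta>) (XR \<beta>))"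
      if "\<kappa> \<in> N" "\<mu> \<in> N" "\<nu> \<in> N" for \<kappa> \<mu> \<nu>
      using that by (simp add: bX br_sum br_scale2 flip: collect)
    show ?thesis
      unfolding J_def *[OF N] *[OF N(2,3,1)] *[OF N(3,1,2)]
      by (rule null) (rule Cjac[OF N])
  qed
  have JXXT: "J (XR \<kappa>) (XR \<mu>) (Tinv \<rho> \<nu>) = 0"
    if N: "\<kappa> \<in> N" "\<mu> \<in> N" "\<rho> \<in> N" "\<nu> \<in> N" for \<kappa> \<mu> \<rho> \<nu>
  proof -
    have 1: "br (XR \<kappa>) (br (XR \<mu>) (Tinv \<rho> \<nu>)) =
        (\<Sum>\<beta>\<in>N. scaleR (\<Sum>\<alpha>\<in>N. C \<mu> \<alpha> \<nu> * C \<kappa> \<beta> \<alpha>) (Tinv \<rho> \<beta>))"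
      using N by (simp add: bXT br_sum br_scale2 br_minus sum_negf flip: collect)
    have 2: "br (XR \<mu>) (br (Tinv \<rho> \<nu>) (XR \<kappa>)) =
        (\<Sum>\<beta>\<in>N. scaleR (- (\<Sum>\<alpha>\<in>N. C \<kappa> \<alpha> \<nu> * C \<mu> \<beta> \<alpha>)) (Tinv \<rho> \<beta>))"
      using N by (simp add: bXT bTX br_sum br_scale2 br_minus sum_negf flip: collect)
    have 3: "br (Tinv \<rho> \<nu>) (br (XR \<kappa>) (XR \<mu>)) =
        (\<Sum>\<beta>\<in>N. scaleR (\<Sum>\<alpha>\<in>N. C \<kappa> \<mu> \<alpha> * C \<alpha> \<beta> \<nu>) (Tinv \<rho> \<beta>))"
      using N by (simp add: bTX bX br_sum br_scale2 flip: collect)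
    have "(\<Sum>\<alpha>\<in>N. C \<mu> \<alpha> \<nu> * C \<kappa> \<beta> \<alpha>) - (\<Sum>\<alpha>\<in>N. C \<kappa> \<alpha> \<nu> * C \<mu> \<beta> \<alpha>)
        + (\<Sum>\<alpha>\<in>N. C \<kappa> \<mu> \<alpha> * C \<alpha> \<beta> \<nu>) = 0" if "\<beta> \<in> N" for \<beta>
    proof -
      have "(\<Sum>\<alpha>\<in>N. C \<beta> \<mu> \<alpha> * C \<kappa> \<alpha> \<nu>) = - (\<Sum>\<alpha>\<in>N. C \<kappa> \<alpha> \<nu> * C \<mu> \<beta> \<alpha>)"
        unfolding sum_negf[symmetric]
      proof (rule sum.cong[OF refl])
        fix \<alpha> assume "\<alpha> \<in> N"
        then show "C \<beta> \<mu> \<alpha> * C \<kappa> \<alpha> \<nu> = - (C \<kappa> \<alpha> \<nu> * C \<mu> \<beta> \<alpha>)"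
          using Canti[of \<beta> \<mu> \<alpha>] N that by simp
      qed
      moreover have "(\<Sum>\<alpha>\<in>N. C \<mu> \<kappa> \<alpha> * C \<beta> \<alpha> \<nu>) = (\<Sum>\<alpha>\<in>N. C \<kappa> \<mu> \<alpha> * C \<alpha> \<beta> \<nu>)"
      proof (rule sum.cong[OF refl])
        fix \<alpha> assume "\<alpha> \<in> N"
        then show "C \<mu> \<kappa> \<alpha> * C \<beta> \<alpha> \<nu> = C \<kappa> \<mu> \<alpha> * C \<alpha> \<beta> \<nu>"
          using Canti[of \<mu> \<kappa> \<alpha>] Canti[of \<beta> \<alpha> \<nu>] N that by simp
      qed
      ultimately show ?thesis
        using Cjac[OF N(2,1) that N(4)] by (simp add: mult.commute)
    qed
    then show ?thesis
      unfolding J_def 1 2 3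
      by (intro null) simp
  qed
  have JXTT: "J (XR \<kappa>) (Tinv \<sigma> \<mu>) (Tinv \<rho> \<nu>) = 0"
    if N: "\<kappa> \<in> N" "\<sigma> \<in> N" "\<mu> \<in> N" "\<rho> \<in> N" "\<nu> \<in> N" for \<kappa> \<sigma> \<mu> \<rho> \<nu>
    using N by (simp add: J_def bXT bTX bTT br_0 br_minus br_sum br_scale2)
  have JTTT: "J (Tinv \<kappa> \<tau>) (Tinv \<sigma> \<mu>) (Tinv \<rho> \<nu>) = 0"
    if N: "\<kappa> \<in> N" "\<tau> \<in> N" "\<sigma> \<in> N" "\<mu> \<in> N" "\<rho> \<in> N" "\<nu> \<in> N" for \<kappa> \<tau> \<sigma> \<mu> \<rho> \<nu>
    using N by (simp add: J_def bTT br_0)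
  have Jb: "J (b i) (b j) (b k) = 0" if "i \<in> I" "j \<in> I" "k \<in> I" for i j k
    using that JXXX JXXT JXTT JTTT unfolding I_def b_def
    by (elim UnE imageE) (auto, (metis J_cyc)+)
  have Jac: "J u v w = 0" for u v w
  proof (rule vanish[of "\<lambda>u. J u v w"])
    fix i assume i: "i \<in> I"
    have "J v w (b i) = 0"
    proof (rule vanish[of "\<lambda>v. J v w (b i)"])
      fix j assume j: "j \<in> I"
      have "J w (b i) (b j) = 0"
        by (rule vanish[of "\<lambda>w. J w (b i) (b j)"]) (simp_all add: J_add J_scale Jb i j)
      then show "J (b j) w (b i) = 0" using J_cyc by metis
    qed (simp_all add: J_add J_scale)
    then show "J (b i) v w = 0" using J_cyc by metis
  qed (simp_all add: J_add J_scale)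
  have "lie_algebra scaleR br"
    by unfold_locales
      (use Jac in \<open>simp_all add: br_add1 br_add2 br_scale1 br_scale2 br_self J_def\<close>)
  then show ?thesis
    unfolding N_def[symmetric] by (intro exI[of _ br]) (auto simp: bX bTX bTT)
qed

section \<open>The universal enveloping algebra\<close>

datatype 'a word = Word "'a list"

instantiation word :: (type) monoid_add
begin

definition zero_word :: "'a word"
  where "zero_word = Word []"

fun plus_word :: "'a word \<Rightarrow> 'a word \<Rightarrow> 'a word"
  where "plus_word (Word u) (Word v) = Word (u @ v)"

instance
proof
  fix a b c :: "'a word"
  show "a + b + c = a + (b + c)"
    by (cases a; cases b; cases c) simp
  show "0 + a = a" "a + 0 = a"
    by (cases a; simp add: zero_word_def)+
qed

end

text \<open>
  Words form a free monoid, written additively, so the convolution product of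
  \<^theory>\<open>HOL-Library.Poly_Mapping\<close> turns finitely supported functions on words
  into the free associative unital algebra.
\<close>

type_synonym ('k, 'a) free_alg = "'a word \<Rightarrow>\<^sub>0 'k"

definition free_ring :: "('k::field, 'a) free_alg ring"
  where "free_ring = \<lparr>carrier = UNIV, mult = (*), one = 1, zero = 0, add = (+)\<rparr>"

definition const :: "'k::field \<Rightarrow> ('k, 'a) free_alg"
  where "const c = Poly_Mapping.single 0 c"

definition letter :: "'a \<Rightarrow> ('k::field, 'a) free_alg"
  where "letter x = Poly_Mapping.single (Word [x]) 1"

text \<open>
  The letters are all vectors of the Lie algebra, not only the members of a basis.
  The first two families of relations cut the free algebra on this set down to the
  tensor algebra of the underlying vector space, the third one cuts the
  tensor algebra down to the universal enveloping algebra.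
\<close>

definition UEA_relations ::
  "('k::field \<Rightarrow> 'g::ab_group_add \<Rightarrow> 'g) \<Rightarrow> ('g \<Rightarrow> 'g \<Rightarrow> 'g) \<Rightarrow> ('k, 'g) free_alg set"
  where "UEA_relations scale bracket =
    {letter (x + y) - (letter x + letter y) | x y. True} \<union>
    {letter (scale c x) - const c * letter x | c x. True} \<union>
    {letter x * letter y - letter y * letter x - letter (bracket x y) | x y. True}"

definition UEA_ideal ::
  "('k::field \<Rightarrow> 'g::ab_group_add \<Rightarrow> 'g) \<Rightarrow> ('g \<Rightarrow> 'g \<Rightarrow> 'g) \<Rightarrow> ('k, 'g) free_alg set"
  where "UEA_ideal scale bracket = genideal free_ring (UEA_relations scale bracket)"

definition UEA_class ::
  "('k::field \<Rightarrow> 'g::ab_group_add \<Rightarrow> 'g) \<Rightarrow> ('g \<Rightarrow> 'g \<Rightarrow> 'g) \<Rightarrow>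
    ('k, 'g) free_alg \<Rightarrow> ('k, 'g) free_alg set"
  where "UEA_class scale bracket p = a_r_coset free_ring (UEA_ideal scale bracket) p"

text \<open>
  The universal enveloping algebra is the quotient ring together with its scalar multiplication,
  which is multiplication by the classes of the constants.
\<close>

definition UEA ::
  "('k::field \<Rightarrow> 'g::ab_group_add \<Rightarrow> 'g) \<Rightarrow> ('g \<Rightarrow> 'g \<Rightarrow> 'g) \<Rightarrow>
    ('k, ('k, 'g) free_alg set) module"
  where "UEA scale bracket =
    (let Q = free_ring Quot UEA_ideal scale bracket in
      ring.extend Q (module.fields (\<lambda>c u. UEA_class scale bracket (const c) \<otimes>\<^bsub>Q\<^esub> u)))"

definition UEA_of ::
  "('k::field \<Rightarrow> 'g::ab_group_add \<Rightarrow> 'g) \<Rightarrow> ('g \<Rightarrow> 'g \<Rightarrow> 'g) \<Rightarrow> 'g \<Rightarrow> ('k, 'g) free_alg set"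
  where "UEA_of scale bracket x = UEA_class scale bracket (letter x)"

lemma ring_extend:
  assumes "ring Q"
  shows "ring (ring.extend Q m)"
proof -
  interpret ring Q by fact
  have "\<forall>x\<in>carrier Q. \<exists>y\<in>carrier Q. y \<oplus>\<^bsub>Q\<^esub> x = \<zero>\<^bsub>Q\<^esub>"
    using add.l_inv_ex by simp
  then have "abelian_group (ring.extend Q m)"
    by (intro abelian_groupI) (auto simp: ring.defs a_ac)
  moreover have "Group.monoid (ring.extend Q m)"
    by (rule monoidI) (auto simp: ring.defs m_assoc)
  ultimately show ?thesis
    by (rule ringI) (auto simp: ring.defs l_distr r_distr)
qed

lemma ring_free_ring: "ring (free_ring :: ('k::field, 'a) free_alg ring)"
proof -
  have "\<exists>y. x + y = 0" "\<exists>y. y + x = 0" for x :: "('k, 'a) free_alg"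
    by (rule exI[of _ "- x"], simp)+
  then show ?thesis
    unfolding free_ring_def
    by unfold_locales (auto simp: algebra_simps Units_def)
qed

lemma ring_UEA:
  fixes scale :: "'k::field \<Rightarrow> 'g::ab_group_add \<Rightarrow> 'g"
  shows "ring (UEA scale bracket)"
proof -
  interpret R: ring "free_ring :: ('k, 'g) free_alg ring"
    by (rule ring_free_ring)
  interpret ideal "UEA_ideal scale bracket" "free_ring"
    unfolding UEA_ideal_def
    by (rule R.genideal_ideal) (simp add: free_ring_def)
  show ?thesis
    unfolding UEA_def Let_def by (rule ring_extend[OF quotient_is_ring])
qed

section \<open>Left actions\<close>

text \<open>
  A linear map on a tensor product is encoded as a bilinear map.
\<close>

definition left_action ::
  "('k, 'a) module \<Rightarrow> ('k, 'b) module \<Rightarrow> ('a \<Rightarrow> 'b \<Rightarrow> 'b) \<Rightarrow> bool"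
  where "left_action A M act \<longleftrightarrow>
    (\<forall>a\<in>carrier A. \<forall>x\<in>carrier M. act a x \<in> carrier M) \<and>
    (\<forall>a\<in>carrier A. \<forall>b\<in>carrier A. \<forall>x\<in>carrier M. act (a \<oplus>\<^bsub>A\<^esub> b) x = act a x \<oplus>\<^bsub>M\<^esub> act b x) \<and>
    (\<forall>a\<in>carrier A. \<forall>x\<in>carrier M. \<forall>y\<in>carrier M. act a (x \<oplus>\<^bsub>M\<^esub> y) = act a x \<oplus>\<^bsub>M\<^esub> act a y) \<and>
    (\<forall>c. \<forall>a\<in>carrier A. \<forall>x\<in>carrier M. act (c \<odot>\<^bsub>A\<^esub> a) x = c \<odot>\<^bsub>M\<^esub> act a x) \<and>
    (\<forall>c. \<forall>a\<in>carrier A. \<forall>x\<in>carrier M. act a (c \<odot>\<^bsub>M\<^esub> x) = c \<odot>\<^bsub>M\<^esub> act a x) \<and>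
    (\<forall>a\<in>carrier A. \<forall>b\<in>carrier A. \<forall>x\<in>carrier M. act (a \<otimes>\<^bsub>A\<^esub> b) x = act a (act b x)) \<and>
    (\<forall>x\<in>carrier M. act \<one>\<^bsub>A\<^esub> x = x)"

end

theory Submission
  imports Defs
begin

text \<open>
  The coproduct rule says that \<open>p \<mapsto> (T\<^sup>-\<^sup>1\<^sub>\<mu>\<^sub>\<nu> p)\<close>, read as a matrix with row \<open>\<nu>\<close> and column \<open>\<mu>\<close>, is an
  algebra homomorphism from the enveloping algebra to matrices over it. Applying the commutator
  with \<open>X\<^sub>\<kappa>\<close> to \<open>1\<close> forces \<open>X\<^sub>\<kappa> \<mapsto> X\<^sub>\<kappa> I + ad X\<^sub>\<kappa>\<close>, and this does define a homomorphism because
  \<open>ad\<close> is a representation. The entries commute with each other as operators: both composites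
  agree on \<open>1\<close> and behave in the same way under left multiplication by a letter. All operators
  are built on the free algebra, where a linear map is given by its values on words, and then shown
  to preserve the defining ideals; no basis of the enveloping algebra is needed.
\<close>

section \<open>The free algebra\<close>

lemma const_0 [simp]: "const 0 = 0"
  by (simp add: const_def)

lemma const_1 [simp]: "const 1 = 1"
  by (simp add: const_def)

lemma const_add: "const (a + b) = const a + const b"
  by (simp add: const_def single_add)

lemma const_mult: "const (a * b) = const a * const b"
  by (simp add: const_def mult_single)

lemma const_sum: "const (sum f S) = (\<Sum>i\<in>S. const (f i))"
  by (induction S rule: infinite_finite_induct) (simp_all add: const_add)

lemma const_mult_single: "const c * Poly_Mapping.single w d = Poly_Mapping.single w (c * d)"
  by (simp add: const_def mult_single)

lemma letter_mult_single:
  "letter x * Poly_Mapping.single (Word w) c = Poly_Mapping.single (Word (x # w)) c"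
  by (simp add: letter_def mult_single)

text \<open>A finitely supported function is built by adding one word at a time. As the word is new,
  updating its coefficient amounts to adding a one-word term.\<close>

lemma free_alg_single_induct [case_names single add]:
  fixes p :: "('k::field, 'a) free_alg"
  assumes single: "\<And>w c. P (Poly_Mapping.single (Word w) c)"
    and add: "\<And>p q. P p \<Longrightarrow> P q \<Longrightarrow> P (p + q)"
  shows "P p"
proof (induction p rule: Poly_Mapping.update_induct)
  case const
  then show ?case using single[of "[]" 0] by simp
next
  case (update f u c)
  have "Poly_Mapping.update u c f = Poly_Mapping.single u c + f"
    using update.hyps
    by (intro poly_mapping_eqI)
      (auto simp: lookup_update lookup_add lookup_single in_keys_iff when_def)
  moreover have "P (Poly_Mapping.single u c)"
    using single by (cases u) simp
  ultimately show ?case using add update.IH by simp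
qed

text \<open>Words arise from the empty word by prepending letters. The operators below are
  characterized by their behaviour under left multiplication by a letter, and this induction fits
  them.\<close>

lemma free_alg_induct [case_names one letter add const]:
  fixes p :: "('k::field, 'a) free_alg"
  assumes one: "P 1"
    and letter: "\<And>x p. P p \<Longrightarrow> P (letter x * p)"
    and add: "\<And>p q. P p \<Longrightarrow> P q \<Longrightarrow> P (p + q)"
    and const: "\<And>c p. P p \<Longrightarrow> P (const c * p)"
  shows "P p"
proof (induction p rule: free_alg_single_induct)
  case (single w c)
  have "P (Poly_Mapping.single (Word w) 1)"
  proof (induction w)
    case Nil
    have "Poly_Mapping.single (Word []) 1 = (1 :: ('k, 'a) free_alg)"
      by (simp flip: zero_word_def)
    then show ?case using one by simp
  next
    case (Cons x w)
    then show ?case using letter[OF Cons.IH, of x] by (simp add: letter_mult_single)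
  qed
  from const[OF this, of c] show ?case by (simp add: const_mult_single)
qed (rule add)

text \<open>Scalars are central because the empty word is neutral on both sides and the field is
  commutative.\<close>

lemma const_commute: "p * const c = const c * p"
proof (induction p rule: free_alg_single_induct)
  case (single w d)
  have "Word w + 0 = 0 + Word w" by (simp add: zero_word_def)
  then show ?case by (simp add: const_def mult_single mult.commute)
qed (simp add: algebra_simps)

lemma const_left_commute: "p * (const c * q) = const c * (p * q)"
  by (metis const_commute mult.assoc)

section \<open>Linear maps given by their values on words\<close>

definition lin_ext :: "('a list \<Rightarrow> ('k::field, 'b) free_alg) \<Rightarrow> ('k, 'a) free_alg \<Rightarrow> ('k, 'b) free_alg"
  where "lin_ext f p =
    (\<Sum>u\<in>Poly_Mapping.keys p. const (Poly_Mapping.lookup p u) * (case u of Word w \<Rightarrow> f w))"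

text \<open>Two elements can thus be summed over a common support, where additivity is
  distributivity.\<close>

lemma lin_ext_superset:
  assumes "finite S" "Poly_Mapping.keys p \<subseteq> S"
  shows "lin_ext f p = (\<Sum>u\<in>S. const (Poly_Mapping.lookup p u) * (case u of Word w \<Rightarrow> f w))"
  unfolding lin_ext_def using assms
  by (intro sum.mono_neutral_left) (auto simp: in_keys_iff)

lemma lin_ext_add: "lin_ext f (p + q) = lin_ext f p + lin_ext f q"
proof -
  let ?S = "Poly_Mapping.keys p \<union> Poly_Mapping.keys q"
  have "finite ?S" "Poly_Mapping.keys (p + q) \<subseteq> ?S"
    by (simp_all add: Poly_Mapping.keys_add)
  then show ?thesis
    by (simp add: lin_ext_superset[where S = ?S] lookup_add const_add distrib_right sum.distrib)
qed

lemma lin_ext_0 [simp]: "lin_ext f 0 = 0"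
  by (simp add: lin_ext_def)

lemma lin_ext_single: "lin_ext f (Poly_Mapping.single (Word w) c) = const c * f w"
  by (cases "c = 0") (simp_all add: lin_ext_def)

lemma lin_ext_1: "lin_ext (f :: 'a list \<Rightarrow> ('k::field, 'b) free_alg) 1 = f []"
proof -
  have "(1 :: ('k, 'a) free_alg) = Poly_Mapping.single (Word []) 1"
    by (simp flip: zero_word_def)
  then show ?thesis using lin_ext_single[of f "[]" 1] by simp
qed

lemma lin_ext_const: "lin_ext f (const c * p) = const c * lin_ext f p"
  by (induction p rule: free_alg_single_induct)
    (simp_all add: const_mult_single lin_ext_single const_mult mult.assoc lin_ext_add distrib_left)

text \<open>Shifting \<open>f\<close> by one letter turns a recursion on words into a recursion for
  left multiplication by a letter.\<close>

lemma lin_ext_letter: "lin_ext f (letter x * p) = lin_ext (\<lambda>w. f (x # w)) p"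
  by (induction p rule: free_alg_single_induct)
    (simp_all add: letter_mult_single lin_ext_single lin_ext_add distrib_left)

lemma lin_ext_comp:
  assumes "\<And>p q. g (p + q) = g p + g q" "\<And>c p. g (const c * p) = const c * g p"
  shows "lin_ext (\<lambda>w. g (f w)) p = g (lin_ext f p)"
  by (induction p rule: free_alg_single_induct) (simp_all add: lin_ext_single lin_ext_add assms)

lemma lin_ext_fun_add: "lin_ext (\<lambda>w. f w + g w) p = lin_ext f p + lin_ext g p"
  by (induction p rule: free_alg_single_induct)
    (simp_all add: lin_ext_single lin_ext_add algebra_simps)

lemma lin_ext_fun_sum: "lin_ext (\<lambda>w. \<Sum>i\<in>S. f i w) p = (\<Sum>i\<in>S. lin_ext (f i) p)"
  by (induction p rule: free_alg_single_induct)
    (simp_all add: lin_ext_single lin_ext_add sum_distrib_left sum.distrib)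

section \<open>The enveloping algebra as a quotient of the free algebra\<close>

lemma free_ring_simps [simp]:
  "carrier free_ring = UNIV" "mult free_ring = (*)" "one free_ring = 1"
  "zero free_ring = 0" "add free_ring = (+)"
  by (simp_all add: free_ring_def)

lemma free_ring_idealI:
  fixes K :: "('k::field, 'a) free_alg set"
  assumes "0 \<in> K" "\<And>p q. p \<in> K \<Longrightarrow> q \<in> K \<Longrightarrow> p + q \<in> K"
    and l: "\<And>p q. p \<in> K \<Longrightarrow> q * p \<in> K" and "\<And>p q. p \<in> K \<Longrightarrow> p * q \<in> K"
  shows "ideal K free_ring"
proof -
  interpret R: ring "free_ring :: ('k, 'a) free_alg ring" by (rule ring_free_ring)
  have inv: "\<ominus>\<^bsub>free_ring\<^esub> p = - p" for p :: "('k, 'a) free_alg"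
    by (rule R.minus_equality) simp_all
  have "additive_subgroup K free_ring"
  proof (rule additive_subgroup.intro, rule R.add.subgroupI)
    fix p assume "p \<in> K"
    then show "\<ominus>\<^bsub>free_ring\<^esub> p \<in> K" using l[of p "- 1"] by (simp add: inv)
  qed (use assms in auto)
  then show ?thesis
    by (intro idealI[OF ring_free_ring])
      (use assms in \<open>auto simp: additive_subgroup_def\<close>)
qed

lemma ideal_UEA_ideal: "ideal (UEA_ideal scale bracket) free_ring"
  unfolding UEA_ideal_def by (rule ring.genideal_ideal[OF ring_free_ring]) simp

context
  fixes scale :: "'k::field \<Rightarrow> 'g::ab_group_add \<Rightarrow> 'g" and bracket :: "'g \<Rightarrow> 'g \<Rightarrow> 'g"
begin

private abbreviation (input) "J \<equiv> UEA_ideal scale bracket"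
private abbreviation (input) "cl \<equiv> UEA_class scale bracket"
private abbreviation (input) "U \<equiv> UEA scale bracket"

interpretation I: ideal J free_ring by (rule ideal_UEA_ideal)

lemma UEA_ideal_0 [simp]: "0 \<in> J"
  using additive_subgroup.zero_closed[OF I.is_additive_subgroup] by simp

lemma UEA_ideal_add: "p \<in> J \<Longrightarrow> q \<in> J \<Longrightarrow> p + q \<in> J"
  using additive_subgroup.a_closed[OF I.is_additive_subgroup] by simp

lemma UEA_ideal_lmult: "p \<in> J \<Longrightarrow> q * p \<in> J"
  using I.I_l_closed[of p q] by simp

lemma UEA_ideal_rmult: "p \<in> J \<Longrightarrow> p * q \<in> J"
  using I.I_r_closed[of p q] by simp

lemma UEA_ideal_uminus: "p \<in> J \<Longrightarrow> - p \<in> J"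
  using UEA_ideal_lmult[of p "- 1"] by simp

lemma UEA_ideal_sum: "(\<And>i. i \<in> S \<Longrightarrow> f i \<in> J) \<Longrightarrow> sum f S \<in> J"
  by (induction S rule: infinite_finite_induct) (auto intro: UEA_ideal_add)

lemma UEA_relations_ideal: "UEA_relations scale bracket \<subseteq> J"
  unfolding UEA_ideal_def using ring.genideal_self[OF ring_free_ring] by auto

lemma UEA_ideal_relI:
  "letter (x + y) - (letter x + letter y) \<in> J"
  "letter (scale c x) - const c * letter x \<in> J"
  "letter x * letter y - letter y * letter x - letter (bracket x y) \<in> J"
  by (rule subsetD[OF UEA_relations_ideal], unfold UEA_relations_def, blast)+

text \<open>By minimality of the generated ideal, it suffices that the elements with property
  \<open>P\<close> form an ideal containing the relations. Maps are shown to respect the quotient in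
  this way.\<close>

lemma UEA_ideal_induct [consumes 1, case_names add_rel scale_rel bracket_rel zero add lmult rmult]:
  assumes "p \<in> J"
    and "\<And>x y. P (letter (x + y) - (letter x + letter y))"
    and "\<And>c x. P (letter (scale c x) - const c * letter x)"
    and "\<And>x y. P (letter x * letter y - letter y * letter x - letter (bracket x y))"
    and "P 0" "\<And>p q. P p \<Longrightarrow> P q \<Longrightarrow> P (p + q)"
    and "\<And>p q. P p \<Longrightarrow> P (q * p)" "\<And>p q. P p \<Longrightarrow> P (p * q)"
  shows "P p"
proof -
  have "ideal (Collect P) free_ring"
    by (rule free_ring_idealI) (use assms in auto)
  moreover have "UEA_relations scale bracket \<subseteq> Collect P"
    unfolding UEA_relations_def using assms(2-4) by auto
  ultimately have "J \<subseteq> Collect P"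
    unfolding UEA_ideal_def by (rule ring.genideal_minimal[OF ring_free_ring])
  then show ?thesis using assms(1) by auto
qed

lemma UEA_class_eq_iff: "cl p = cl q \<longleftrightarrow> p - q \<in> J"
proof -
  have set: "cl p = {i + p | i. i \<in> J}" for p
    by (auto simp: UEA_class_def a_r_coset_def r_coset_def)
  show ?thesis
  proof
    assume "cl p = cl q"
    moreover have "p \<in> cl p" unfolding set using UEA_ideal_0 by force
    ultimately show "p - q \<in> J" unfolding set by auto
  next
    \<comment> \<open>One inclusion suffices: interchanging \<open>p\<close> and \<open>q\<close>
      replaces the difference by its negative, again in the ideal.\<close>
    have sub: "cl p \<subseteq> cl q" if "p - q \<in> J" for p q
    proof
      fix r assume "r \<in> cl p"
      then obtain i where "i \<in> J" "r = i + p" unfolding set by auto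
      then have "i + (p - q) \<in> J" "r = (i + (p - q)) + q"
        using UEA_ideal_add that by auto
      then show "r \<in> cl q" unfolding set by blast
    qed
    assume "p - q \<in> J"
    then show "cl p = cl q"
      using sub[of p q] sub[of q p] UEA_ideal_uminus[of "p - q"] by auto
  qed
qed

section \<open>The operations of the enveloping algebra on representatives\<close>

lemma carrier_UEA: "carrier U = range cl"
  by (auto simp: UEA_def Let_def ring.defs FactRing_def A_RCOSETS_def' UEA_class_def)

lemma UEA_one: "\<one>\<^bsub>U\<^esub> = cl 1"
  by (simp add: UEA_def Let_def ring.defs FactRing_def UEA_class_def)

lemma UEA_mult: "cl p \<otimes>\<^bsub>U\<^esub> cl q = cl (p * q)"
  using I.rcoset_mult_add[of p q]
  by (simp add: UEA_def Let_def ring.defs FactRing_def UEA_class_def)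

lemma UEA_add: "cl p \<oplus>\<^bsub>U\<^esub> cl q = cl (p + q)"
  using I.a_rcos_sum[of p q]
  by (simp add: UEA_def Let_def ring.defs FactRing_def UEA_class_def)

lemma UEA_smult: "c \<odot>\<^bsub>U\<^esub> cl p = cl (const c * p)"
  using I.rcoset_mult_add[of "const c" p]
  by (simp add: UEA_def Let_def ring.defs module.defs FactRing_def UEA_class_def)

lemma UEA_zero: "\<zero>\<^bsub>U\<^esub> = cl 0"
proof -
  have "\<zero>\<^bsub>U\<^esub> = J" by (simp add: UEA_def Let_def ring.defs FactRing_def)
  also have "J = cl 0" by (auto simp: UEA_class_def a_r_coset_def r_coset_def)
  finally show ?thesis .
qed

lemma UEA_finsum:
  assumes "finite S"
  shows "(\<Oplus>\<^bsub>U\<^esub>i\<in>S. cl (f i)) = cl (sum f S)"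
proof -
  interpret ring U by (rule ring_UEA)
  show ?thesis
    using assms by induction (simp_all add: finsum_insert Pi_def carrier_UEA UEA_zero UEA_add)
qed

end

section \<open>Coordinates with respect to a finite basis\<close>

context vector_space
begin

text \<open>Injectivity of \<open>b\<close> on \<open>I\<close> allows coordinates to be indexed by
  \<open>I\<close> instead of by the basis vectors.\<close>

lemma basis_family_coordinates:
  assumes "finite I" "basis_family I b"
  obtains co where "\<And>u v i. co (u + v) i = co u i + co v i"
    and "\<And>c v i. co (scale c v) i = c * co v i"
    and "\<And>i j. i \<in> I \<Longrightarrow> j \<in> I \<Longrightarrow> co (b j) i = (if i = j then 1 else 0)"
    and "\<And>v. v = (\<Sum>i\<in>I. scale (co v i) (b i))"
proof
  have inj: "inj_on b I" and ind: "independent (b ` I)" and sp: "span (b ` I) = UNIV"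
    using assms by (auto simp: basis_family_def)
  let ?co = "\<lambda>v i. representation (b ` I) v (b i)"
  show "?co (u + v) i = ?co u i + ?co v i" for u v i
    by (simp add: representation_add[OF ind] sp)
  show "?co (scale c v) i = c * ?co v i" for c v i
    by (simp add: representation_scale[OF ind] sp)
  show "?co (b j) i = (if i = j then 1 else 0)" if "i \<in> I" "j \<in> I" for i j
    using that inj by (auto simp: representation_basis[OF ind] inj_on_def)
  show "v = (\<Sum>i\<in>I. scale (?co v i) (b i))" for v
  proof -
    have "(\<Sum>w\<in>b ` I. scale (representation (b ` I) v w) w) = v"
      using assms by (intro sum_representation_eq[OF ind]) (auto simp: sp)
    then show ?thesis by (simp add: sum.reindex[OF inj])
  qed
qed

end

section \<open>Identities for the bracket\<close>

lemma (in lie_algebra) bracket_0 [simp]: "bracket x 0 = 0" "bracket 0 x = 0"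
  using bracket_add_right[of x 0 0] bracket_add_left[of 0 0 x] by simp_all

lemma (in lie_algebra) bracket_anti: "bracket y x = - bracket x y"
proof -
  have "bracket (x + y) (x + y) = 0" by (rule bracket_self)
  then have "bracket x y + bracket y x = 0"
    unfolding bracket_add_left bracket_add_right by (simp add: bracket_self add.commute)
  then show ?thesis by (metis add.commute eq_neg_iff_add_eq_0)
qed

lemma (in lie_algebra) bracket_sum_right: "bracket x (sum f S) = (\<Sum>i\<in>S. bracket x (f i))"
  by (induction S rule: infinite_finite_induct) (simp_all add: bracket_add_right)

lemma (in lie_algebra) bracket_minus_right: "bracket x (- y) = - bracket x y"
  using bracket_add_right[of x y "- y"] by (simp add: eq_neg_iff_add_eq_0 add.commute)

text \<open>The Jacobi identity, in the form that \<open>ad\<close> is a representation.\<close>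

lemma (in lie_algebra) bracket_bracket:
  "bracket (bracket x y) z = bracket x (bracket y z) - bracket y (bracket x z)"
proof -
  have "bracket x (bracket y z) + - bracket y (bracket x z) + - bracket (bracket x y) z = 0"
    using jacobi[of x y z] bracket_anti[of z x] bracket_anti[of z "bracket x y"]
    by (simp add: bracket_minus_right)
  then show ?thesis by (simp add: algebra_simps)
qed

section \<open>The twisting homomorphism\<close>

text \<open>Letters of a free algebra may be sent anywhere, so every family of matrices
  \<open>m x\<close> yields a homomorphism. That the matrices represent a Lie algebra enters when
  passing to the quotient.\<close>

locale matrix_twist =
  fixes N :: "'i set" and m :: "'a \<Rightarrow> 'i \<Rightarrow> 'i \<Rightarrow> 'k::field"
  assumes finite_N [simp]: "finite N"
begin

text \<open>For indices in \<open>N\<close>, an entry of the product of the matrices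
  \<open>x I + m x\<close> over the letters of the word, expanded along the first factor; the empty
  product is the identity matrix.\<close>

primrec twist_word :: "'a list \<Rightarrow> 'i \<Rightarrow> 'i \<Rightarrow> ('k, 'a) free_alg"
  where "twist_word [] \<nu> \<mu> = (if \<nu> = \<mu> then 1 else 0)"
  | "twist_word (x # w) \<nu> \<mu> =
      letter x * twist_word w \<nu> \<mu> + (\<Sum>\<alpha>\<in>N. const (m x \<nu> \<alpha>) * twist_word w \<alpha> \<mu>)"

text \<open>
  The algebra homomorphism into matrices over the free algebra that sends the letter \<open>x\<close> to
  \<open>x I + m x\<close>. With \<open>m\<close> the adjoint representation, the entry \<open>(\<nu>, \<mu>)\<close> is the action of
  \<open>T\<^sup>-\<^sup>1\<^sub>\<mu>\<^sub>\<nu>\<close>: the indices are transposed.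
\<close>
definition twist :: "('k, 'a) free_alg \<Rightarrow> 'i \<Rightarrow> 'i \<Rightarrow> ('k, 'a) free_alg"
  where "twist p \<nu> \<mu> = lin_ext (\<lambda>w. twist_word w \<nu> \<mu>) p"

lemma twist_0 [simp]: "twist 0 \<nu> \<mu> = 0"
  and twist_1: "twist 1 \<nu> \<mu> = (if \<nu> = \<mu> then 1 else 0)"
  and twist_add: "twist (p + q) \<nu> \<mu> = twist p \<nu> \<mu> + twist q \<nu> \<mu>"
  and twist_const: "twist (const c * p) \<nu> \<mu> = const c * twist p \<nu> \<mu>"
  by (simp_all add: twist_def lin_ext_1 lin_ext_add lin_ext_const)

lemma twist_letter_mult:
  "twist (letter x * p) \<nu> \<mu> = letter x * twist p \<nu> \<mu> + (\<Sum>\<alpha>\<in>N. const (m x \<nu> \<alpha>) * twist p \<alpha> \<mu>)"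
proof -
  have comp: "lin_ext (\<lambda>w. q * f w) p = q * lin_ext f p"
    for q and f :: "'a list \<Rightarrow> ('k, 'a) free_alg"
    by (rule lin_ext_comp) (simp_all add: distrib_left const_left_commute)
  show ?thesis
    by (simp add: twist_def lin_ext_letter lin_ext_fun_add lin_ext_fun_sum comp)
qed

lemma twist_minus: "twist (- p) \<nu> \<mu> = - twist p \<nu> \<mu>"
  using twist_add[of p "- p"] by (simp add: eq_neg_iff_add_eq_0 add.commute)

lemma twist_diff: "twist (p - q) \<nu> \<mu> = twist p \<nu> \<mu> - twist q \<nu> \<mu>"
  using twist_add[of p "- q"] by (simp add: twist_minus)

lemma twist_sum: "twist (sum f S) \<nu> \<mu> = (\<Sum>i\<in>S. twist (f i) \<nu> \<mu>)"
  by (induction S rule: infinite_finite_induct) (simp_all add: twist_add)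

lemma twist_letter:
  assumes "\<mu> \<in> N"
  shows "twist (letter x) \<nu> \<mu> = (if \<nu> = \<mu> then letter x else 0) + const (m x \<nu> \<mu>)"
  using twist_letter_mult[of x 1 \<nu> \<mu>] assms
  by (simp add: twist_1 if_distrib[of "\<lambda>q. _ * q"] cong: if_cong)

text \<open>Multiplicativity read entrywise, the source of the coproduct rule. The recursion for a
  letter mixes rows, so the induction treats all \<nu> in \<open>N\<close> at once.\<close>

lemma twist_mult:
  assumes "\<nu> \<in> N"
  shows "twist (p * q) \<nu> \<mu> = (\<Sum>\<alpha>\<in>N. twist p \<nu> \<alpha> * twist q \<alpha> \<mu>)"
  using assms
proof (induction p arbitrary: \<nu> rule: free_alg_induct)
  case one
  have "(\<Sum>\<alpha>\<in>N. twist 1 \<nu> \<alpha> * twist q \<alpha> \<mu>) = (\<Sum>\<alpha>\<in>N. if \<nu> = \<alpha> then twist q \<nu> \<mu> else 0)"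
    by (intro sum.cong) (auto simp: twist_1)
  then show ?case using one by simp
next
  case (letter x p)
  have "twist (letter x * p * q) \<nu> \<mu> =
      letter x * twist (p * q) \<nu> \<mu> + (\<Sum>\<beta>\<in>N. const (m x \<nu> \<beta>) * twist (p * q) \<beta> \<mu>)"
    by (simp add: mult.assoc twist_letter_mult)
  also have "(\<Sum>\<beta>\<in>N. const (m x \<nu> \<beta>) * twist (p * q) \<beta> \<mu>) =
      (\<Sum>\<beta>\<in>N. \<Sum>\<alpha>\<in>N. const (m x \<nu> \<beta>) * twist p \<beta> \<alpha> * twist q \<alpha> \<mu>)"
    using letter.IH by (simp add: sum_distrib_left mult.assoc)
  \<comment> \<open>Exchanging the sums is associativity of the product of \<open>m x\<close>, the
    matrix of \<open>p\<close> and the matrix of \<open>q\<close>.\<close>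
  also have "\<dots> = (\<Sum>\<alpha>\<in>N. \<Sum>\<beta>\<in>N. const (m x \<nu> \<beta>) * twist p \<beta> \<alpha> * twist q \<alpha> \<mu>)"
    by (rule sum.swap)
  also have "letter x * twist (p * q) \<nu> \<mu> = (\<Sum>\<alpha>\<in>N. letter x * twist p \<nu> \<alpha> * twist q \<alpha> \<mu>)"
    using letter by (simp add: sum_distrib_left mult.assoc)
  finally show ?case
    by (simp add: twist_letter_mult distrib_right sum.distrib sum_distrib_right)
qed (simp_all add: distrib_right twist_add sum.distrib twist_const mult.assoc sum_distrib_left)

text \<open>The scalars from \<open>m x\<close> pass through the outer operator, so a letter
  contributes one sum for each of the two row indices; exchanging the operators merely exchanges
  these sums. On \<open>1\<close> both composites are a product of two Kronecker deltas.\<close>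

lemma twist_commute:
  "twist (twist p \<beta> \<alpha>) \<nu> \<mu> = twist (twist p \<nu> \<mu>) \<beta> \<alpha>"
proof (induction p arbitrary: \<alpha> \<beta> \<mu> \<nu> rule: free_alg_induct)
  case (letter x p)
  have "twist (twist (letter x * p) \<beta> \<alpha>) \<nu> \<mu> =
     letter x * twist (twist p \<beta> \<alpha>) \<nu> \<mu>
     + (\<Sum>\<gamma>\<in>N. const (m x \<nu> \<gamma>) * twist (twist p \<beta> \<alpha>) \<gamma> \<mu>)
     + (\<Sum>\<gamma>\<in>N. const (m x \<beta> \<gamma>) * twist (twist p \<gamma> \<alpha>) \<nu> \<mu>)" for \<alpha> \<beta> \<mu> \<nu>
    by (simp add: twist_letter_mult twist_add twist_sum twist_const)
  then show ?case
    by (simp only: letter.IH[of \<beta> \<alpha> \<nu> \<mu>] letter.IH[of _ \<alpha> \<nu> \<mu>] letter.IH[of \<beta> \<alpha> _ \<mu>] add_ac)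
qed (simp_all add: twist_1 twist_add twist_const)

end

section \<open>The action\<close>

text \<open>The index type is arbitrary, so that the locale covers both the given Lie algebra and
  the extended one, whose index set is a disjoint union.\<close>

locale lie_basis = lie_algebra scale bracket
  for scale :: "'k::field \<Rightarrow> 'g::ab_group_add \<Rightarrow> 'g" and bracket +
  fixes N :: "'i set" and X :: "'i \<Rightarrow> 'g" and co :: "'g \<Rightarrow> 'i \<Rightarrow> 'k"
  assumes finite_basis: "finite N"
    and co_add: "co (u + v) i = co u i + co v i"
    and co_scale: "co (scale c v) i = c * co v i"
    and co_basis: "i \<in> N \<Longrightarrow> j \<in> N \<Longrightarrow> co (X j) i = (if i = j then 1 else 0)"
    and co_expand: "v = (\<Sum>i\<in>N. scale (co v i) (X i))"
begin

section \<open>The adjoint representation in coordinates\<close>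

definition ad_mat :: "'g \<Rightarrow> 'i \<Rightarrow> 'i \<Rightarrow> 'k"
  where "ad_mat x \<nu> \<mu> = co (bracket x (X \<mu>)) \<nu>"

sublocale matrix_twist N ad_mat
  by unfold_locales (rule finite_basis)

lemma co_0: "co 0 i = 0"
  using co_scale[of 0 0 i] by simp

lemma co_minus: "co (- v) i = - co v i"
  using co_add[of v "- v" i] by (simp add: co_0 eq_neg_iff_add_eq_0 add.commute)

lemma co_sum: "co (sum f S) i = (\<Sum>j\<in>S. co (f j) i)"
  by (induction S rule: infinite_finite_induct) (simp_all add: co_0 co_add)

lemma ad_mat_add: "ad_mat (x + y) \<nu> \<mu> = ad_mat x \<nu> \<mu> + ad_mat y \<nu> \<mu>"
  by (simp add: ad_mat_def bracket_add_left co_add)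

lemma ad_mat_scale: "ad_mat (scale c x) \<nu> \<mu> = c * ad_mat x \<nu> \<mu>"
  by (simp add: ad_mat_def bracket_scale_left co_scale)

lemma ad_mat_bracket:
  "ad_mat (bracket x y) \<nu> \<mu> =
    (\<Sum>\<alpha>\<in>N. ad_mat x \<nu> \<alpha> * ad_mat y \<alpha> \<mu>) - (\<Sum>\<alpha>\<in>N. ad_mat y \<nu> \<alpha> * ad_mat x \<alpha> \<mu>)"
proof -
  \<comment> \<open>The matrix of a composite is a matrix product: the inner bracket is expanded in
    the basis before the outer one is applied.\<close>
  have *: "co (bracket x (bracket y (X \<mu>))) \<nu> = (\<Sum>\<alpha>\<in>N. ad_mat x \<nu> \<alpha> * ad_mat y \<alpha> \<mu>)" for x y
    by (subst co_expand[of "bracket y (X \<mu>)"])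
      (simp add: bracket_sum_right bracket_scale_right co_sum co_scale ad_mat_def mult.commute)
  show ?thesis
    using co_add[of _ "- _"] unfolding ad_mat_def[of "bracket x y"] bracket_bracket
    by (simp add: co_minus * flip: add_uminus_conv_diff)
qed

text \<open>The product of \<open>x I + ad x\<close> and \<open>y I + ad y\<close>. Its two mixed
  terms together are symmetric in \<open>x\<close> and \<open>y\<close>, hence disappear from the
  commutator.\<close>

lemma twist_letter_letter:
  assumes N: "\<nu> \<in> N" "\<mu> \<in> N"
  shows "twist (letter x * letter y) \<nu> \<mu> = (if \<nu> = \<mu> then letter x * letter y else 0)
    + const (ad_mat y \<nu> \<mu>) * letter x + const (ad_mat x \<nu> \<mu>) * letter y
    + const (\<Sum>\<alpha>\<in>N. ad_mat x \<nu> \<alpha> * ad_mat y \<alpha> \<mu>)"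
proof -
  have "(\<Sum>\<alpha>\<in>N. const (ad_mat x \<nu> \<alpha>) * (if \<alpha> = \<mu> then letter y else 0)) =
      const (ad_mat x \<nu> \<mu>) * letter y"
    using N by (simp add: if_distrib[of "\<lambda>q. _ * q"] cong: if_cong)
  then show ?thesis
    using N
    by (simp add: twist_letter_mult twist_letter distrib_left sum.distrib const_sum const_mult
        const_commute[of "letter x"] ac_simps)
qed

abbreviation "J \<equiv> UEA_ideal scale bracket"

text \<open>A defining relation is sent to itself times the identity matrix: the scalar parts cancel
  because \<open>ad\<close> is linear and a representation. The matrix product then handles left and
  right multiples.\<close>

lemma twist_ideal:
  assumes "p \<in> J" "\<nu> \<in> N" "\<mu> \<in> N"
  shows "twist p \<nu> \<mu> \<in> J"
  using assms
proof (induction p arbitrary: \<nu> \<mu> rule: UEA_ideal_induct)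
  case (add_rel x y)
  then show ?case
    using UEA_ideal_relI(1)[of x y scale bracket]
    by (simp add: twist_diff twist_add twist_letter ad_mat_add const_add algebra_simps)
next
  case (scale_rel c x)
  then show ?case
    using UEA_ideal_relI(2)[of scale c x bracket]
    by (simp add: twist_diff twist_const twist_letter ad_mat_scale const_mult algebra_simps)
next
  case (bracket_rel x y)
  have const_diff: "const (a - b) = const a - const b" for a b :: 'k
    by (metis add_diff_cancel const_add diff_add_cancel)
  have "twist (letter x * letter y - letter y * letter x - letter (bracket x y)) \<nu> \<mu> =
      (if \<nu> = \<mu> then letter x * letter y - letter y * letter x - letter (bracket x y) else 0)"
    unfolding twist_diff using bracket_rel
    by (simp add: twist_letter_letter twist_letter ad_mat_bracket const_diff)
  then show ?case
    using UEA_ideal_relI(3)[of x y bracket scale] by simp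
next
  case (lmult p q)
  then show ?case by (auto simp: twist_mult intro!: UEA_ideal_sum UEA_ideal_lmult)
next
  case (rmult p q)
  then show ?case by (auto simp: twist_mult intro!: UEA_ideal_sum UEA_ideal_rmult)
qed (auto simp: twist_add intro: UEA_ideal_add)

text \<open>\<open>letter\<close> is linear only modulo the ideal; the addition and scaling
  relations are carried over to finite combinations.\<close>

lemma letter_sum_scale:
  "letter (\<Sum>i\<in>S. scale (c i) (x i)) - (\<Sum>i\<in>S. const (c i) * letter (x i)) \<in> J"
proof (induction S rule: infinite_finite_induct)
  case (insert i S)
  let ?s = "\<Sum>i\<in>S. scale (c i) (x i)"
  have "(letter (scale (c i) (x i) + ?s) - (letter (scale (c i) (x i)) + letter ?s))
      + (letter (scale (c i) (x i)) - const (c i) * letter (x i))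
      + (letter ?s - (\<Sum>i\<in>S. const (c i) * letter (x i))) \<in> J"
    using insert.IH by (intro UEA_ideal_add UEA_ideal_relI)
  then show ?case using insert.hyps by (simp add: algebra_simps)
\<comment> \<open>The empty sum requires \<open>letter 0\<close> in the ideal: the scaling relation
  at \<open>c = 0\<close>, \<open>x = 0\<close>.\<close>
qed (use UEA_ideal_relI(2)[of scale 0 0 bracket] in auto)

lemma basis_induct [case_names zero add scale basis]:
  assumes "P 0" "\<And>x y. P x \<Longrightarrow> P y \<Longrightarrow> P (x + y)"
    and "\<And>c x. P x \<Longrightarrow> P (scale c x)" "\<And>i. i \<in> N \<Longrightarrow> P (X i)"
  shows "P x"
proof -
  have "P (\<Sum>i\<in>S. scale (c i) (X i))" if "finite S" "S \<subseteq> N" for S c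
    using that by induction (use assms in auto)
  from this[OF finite_basis order_refl, of "co x"] show ?thesis
    by (simp flip: co_expand)
qed

end

text \<open>Structure constants enter as adjoint matrix entries: C_{\<kappa>\<alpha>\<nu>} stands in
  row \<nu> and column \<alpha> of ad X_\<kappa>.\<close>

locale extended_lie_basis =
  g: lie_basis scale bracket N X co +
  h: lie_basis scaleR bracketR "Inl ` N \<union> Inr ` (N \<times> N)"
    "case_sum XR (\<lambda>(\<mu>, \<nu>). Tinv \<mu> \<nu>)" coR
  for scale :: "'k::field \<Rightarrow> 'g::ab_group_add \<Rightarrow> 'g" and bracket
    and N :: "'i set" and X co
    and scaleR :: "'k \<Rightarrow> 'h::ab_group_add \<Rightarrow> 'h" and bracketR XR Tinv coR +
  assumes bracket_XX: "\<mu> \<in> N \<Longrightarrow> \<nu> \<in> N \<Longrightarrow>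
      bracketR (XR \<mu>) (XR \<nu>) = (\<Sum>\<alpha>\<in>N. scaleR (g.ad_mat (X \<mu>) \<alpha> \<nu>) (XR \<alpha>))"
    and bracket_TT: "\<alpha> \<in> N \<Longrightarrow> \<beta> \<in> N \<Longrightarrow> \<mu> \<in> N \<Longrightarrow> \<nu> \<in> N \<Longrightarrow>
      bracketR (Tinv \<alpha> \<beta>) (Tinv \<mu> \<nu>) = 0"
    and bracket_TX: "\<mu> \<in> N \<Longrightarrow> \<nu> \<in> N \<Longrightarrow> \<kappa> \<in> N \<Longrightarrow>
      bracketR (Tinv \<mu> \<nu>) (XR \<kappa>) = (\<Sum>\<alpha>\<in>N. scaleR (g.ad_mat (X \<kappa>) \<nu> \<alpha>) (Tinv \<mu> \<alpha>))"
begin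

abbreviation "idx \<equiv> Inl ` N \<union> Inr ` (N \<times> N)"

section \<open>Operators attached to the elements of the extended Lie algebra\<close>

definition basis_op :: "'i + 'i \<times> 'i \<Rightarrow> ('k, 'g) free_alg \<Rightarrow> ('k, 'g) free_alg"
  where "basis_op i p = (case i of Inl \<mu> \<Rightarrow> letter (X \<mu>) * p | Inr (\<mu>, \<nu>) \<Rightarrow> g.twist p \<nu> \<mu>)"

text \<open>All vectors are letters, so the operators prescribed on the basis are extended linearly
  through the coordinates.\<close>

definition lie_op :: "'h \<Rightarrow> ('k, 'g) free_alg \<Rightarrow> ('k, 'g) free_alg"
  where "lie_op x p = (\<Sum>i\<in>idx. const (coR x i) * basis_op i p)"

text \<open>\<open>foldr\<close> lets the last letter act first, as a left action demands.\<close>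

definition free_act :: "('k, 'h) free_alg \<Rightarrow> ('k, 'g) free_alg \<Rightarrow> ('k, 'g) free_alg"
  where "free_act a p = lin_ext (\<lambda>w. foldr lie_op w p) a"

lemma basis_op_add: "basis_op i (p + q) = basis_op i p + basis_op i q"
  by (simp add: basis_op_def distrib_left g.twist_add split: sum.split)

lemma basis_op_const: "basis_op i (const c * p) = const c * basis_op i p"
  by (simp add: basis_op_def const_left_commute[of _ c] g.twist_const split: sum.split)

lemma basis_op_ideal: "i \<in> idx \<Longrightarrow> p \<in> g.J \<Longrightarrow> basis_op i p \<in> g.J"
  by (auto simp: basis_op_def intro: UEA_ideal_lmult g.twist_ideal)

lemma lie_op_add: "lie_op x (p + q) = lie_op x p + lie_op x q"
  by (simp add: lie_op_def basis_op_add distrib_left sum.distrib)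

lemma lie_op_const: "lie_op x (const c * p) = const c * lie_op x p"
  by (simp add: lie_op_def basis_op_const const_left_commute[of _ c] sum_distrib_left)

lemma lie_op_ideal: "p \<in> g.J \<Longrightarrow> lie_op x p \<in> g.J"
  unfolding lie_op_def by (intro UEA_ideal_sum UEA_ideal_lmult basis_op_ideal)

lemma lie_op_add_left: "lie_op (x + y) p = lie_op x p + lie_op y p"
  by (simp add: lie_op_def h.co_add const_add distrib_right sum.distrib)

lemma lie_op_scale_left: "lie_op (scaleR c x) p = const c * lie_op x p"
  by (simp add: lie_op_def h.co_scale const_mult mult.assoc sum_distrib_left)

lemma lie_op_0_left: "lie_op 0 p = 0"
  by (simp add: lie_op_def h.co_0)

lemma lie_op_minus_left: "lie_op (- x) p = - lie_op x p"
  using lie_op_add_left[of x "- x" p]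
  by (simp add: lie_op_0_left eq_neg_iff_add_eq_0 add.commute)

lemma lie_op_sum_left: "lie_op (sum f S) p = (\<Sum>i\<in>S. lie_op (f i) p)"
  by (induction S rule: infinite_finite_induct) (simp_all add: lie_op_0_left lie_op_add_left)

lemma lie_op_basis:
  assumes "i \<in> idx"
  shows "lie_op (case_sum XR (\<lambda>(\<mu>, \<nu>). Tinv \<mu> \<nu>) i) p = basis_op i p"
proof -
  have "lie_op (case_sum XR (\<lambda>(\<mu>, \<nu>). Tinv \<mu> \<nu>) i) p =
      (\<Sum>j\<in>idx. if j = i then basis_op i p else 0)"
    unfolding lie_op_def using assms by (intro sum.cong) (auto simp: h.co_basis)
  then show ?thesis using assms h.finite_basis by simp
qed

lemma lie_op_X: "\<mu> \<in> N \<Longrightarrow> lie_op (XR \<mu>) p = letter (X \<mu>) * p"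
  using lie_op_basis[of "Inl \<mu>"] by (simp add: basis_op_def)

lemma lie_op_T: "\<mu> \<in> N \<Longrightarrow> \<nu> \<in> N \<Longrightarrow> lie_op (Tinv \<mu> \<nu>) p = g.twist p \<nu> \<mu>"
  using lie_op_basis[of "Inr (\<mu>, \<nu>)"] by (simp add: basis_op_def)

text \<open>The defect \<open>D\<close> is bilinear and antisymmetric, so basis vectors suffice.
  Pairs involving some T give zero already in the free algebra; two X give an element of the
  ideal.\<close>

lemma lie_op_commutator: "lie_op x (lie_op y p) - lie_op y (lie_op x p) - lie_op (bracketR x y) p \<in> g.J"
proof -
  define D where "D x y = lie_op x (lie_op y p) - lie_op y (lie_op x p) - lie_op (bracketR x y) p" for x y
  have D_anti: "D y x = - D x y" for x y
    using h.bracket_anti[of y x] by (simp add: D_def lie_op_minus_left)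
  have D_add: "D (x + x') y = D x y + D x' y" for x x' y
    by (simp add: D_def lie_op_add_left lie_op_add h.bracket_add_left)
  have D_scale: "D (scaleR c x) y = const c * D x y" for c x y
    by (simp add: D_def lie_op_scale_left lie_op_const h.bracket_scale_left right_diff_distrib)
  have D_0: "D 0 y = 0" for y
    using D_scale[of 0 0 y] by simp
  have XX: "D (XR \<kappa>) (XR \<mu>) \<in> g.J" if N: "\<kappa> \<in> N" "\<mu> \<in> N" for \<kappa> \<mu>
  proof -
    let ?b = "bracket (X \<kappa>) (X \<mu>)"
    have "letter ?b - (\<Sum>\<alpha>\<in>N. const (g.ad_mat (X \<kappa>) \<alpha> \<mu>) * letter (X \<alpha>)) \<in> g.J"
      unfolding g.ad_mat_def
      using g.letter_sum_scale[where S = N and c = "co ?b" and x = X] by (simp flip: g.co_expand)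
    \<comment> \<open>The bracket relation plus the expansion of \<open>letter ?b\<close> in basis
      letters, multiplied by \<open>p\<close>, is the defect.\<close>
    then have "(letter (X \<kappa>) * letter (X \<mu>) - letter (X \<mu>) * letter (X \<kappa>) - letter ?b
        + (letter ?b - (\<Sum>\<alpha>\<in>N. const (g.ad_mat (X \<kappa>) \<alpha> \<mu>) * letter (X \<alpha>)))) * p \<in> g.J"
      by (intro UEA_ideal_rmult UEA_ideal_add UEA_ideal_relI)
    also have "(letter (X \<kappa>) * letter (X \<mu>) - letter (X \<mu>) * letter (X \<kappa>) - letter ?b
        + (letter ?b - (\<Sum>\<alpha>\<in>N. const (g.ad_mat (X \<kappa>) \<alpha> \<mu>) * letter (X \<alpha>)))) * p = D (XR \<kappa>) (XR \<mu>)"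
      using N
      by (simp add: D_def lie_op_X bracket_XX lie_op_sum_left lie_op_scale_left
          left_diff_distrib sum_distrib_right mult.assoc)
    finally show ?thesis .
  qed
  \<comment> \<open>This is the recursion \<open>twist_letter_mult\<close> at the letter
    X_\<kappa>.\<close>
  have TX: "D (Tinv \<mu> \<nu>) (XR \<kappa>) = 0" if N: "\<mu> \<in> N" "\<nu> \<in> N" "\<kappa> \<in> N" for \<mu> \<nu> \<kappa>
    using N by (simp add: D_def lie_op_X lie_op_T bracket_TX g.twist_letter_mult
        lie_op_sum_left lie_op_scale_left)
  have TT: "D (Tinv \<alpha> \<beta>) (Tinv \<mu> \<nu>) = 0"
    if N: "\<alpha> \<in> N" "\<beta> \<in> N" "\<mu> \<in> N" "\<nu> \<in> N" for \<alpha> \<beta> \<mu> \<nu>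
    using N g.twist_commute[of p \<nu> \<mu> \<beta> \<alpha>]
    by (simp add: D_def lie_op_T bracket_TT lie_op_0_left)
  have on_basis: "D (case_sum XR (\<lambda>(\<mu>, \<nu>). Tinv \<mu> \<nu>) i) (case_sum XR (\<lambda>(\<mu>, \<nu>). Tinv \<mu> \<nu>) j) \<in> g.J"
    if "i \<in> idx" "j \<in> idx" for i j
    using that XX TX TT D_anti[of "XR _" "Tinv _ _"] by auto
  have "D x y \<in> g.J"
  proof (induction x rule: h.basis_induct)
    case (basis i)
    \<comment> \<open>Linearity of \<open>D\<close> is at hand in the first argument, so
      \<open>y\<close> is moved there by antisymmetry.\<close>
    have "D y (case_sum XR (\<lambda>(\<mu>, \<nu>). Tinv \<mu> \<nu>) i) \<in> g.J"
    proof (induction y rule: h.basis_induct)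
      case (basis j)
      then show ?case using \<open>i \<in> idx\<close> by (rule on_basis)
    qed (auto simp: D_0 D_add D_scale intro: UEA_ideal_add UEA_ideal_lmult)
    then show ?case
      using D_anti UEA_ideal_uminus by metis
  qed (auto simp: D_0 D_add D_scale intro: UEA_ideal_add UEA_ideal_lmult)
  then show ?thesis by (simp add: D_def)
qed

section \<open>The free algebra of the extended Lie algebra acting on that of the given one\<close>

lemma free_act_one: "free_act 1 p = p"
  and free_act_0_left: "free_act 0 p = 0"
  and free_act_add_left: "free_act (a + b) p = free_act a p + free_act b p"
  and free_act_const_left: "free_act (const c * a) p = const c * free_act a p"
  by (simp_all add: free_act_def lin_ext_1 lin_ext_add lin_ext_const)

lemma free_act_of_const: "free_act (const c) p = const c * p"
  using free_act_const_left[of c 1 p] by (simp add: free_act_one)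

lemma free_act_letter_mult: "free_act (letter x * a) p = lie_op x (free_act a p)"
  unfolding free_act_def lin_ext_letter
  by (simp add: lin_ext_comp[where g = "lie_op x"] lie_op_add lie_op_const)

lemma free_act_letter: "free_act (letter x) p = lie_op x p"
  using free_act_letter_mult[of x 1 p] by (simp add: free_act_one)

lemma free_act_mult: "free_act (a * b) p = free_act a (free_act b p)"
  by (induction a rule: free_alg_induct)
    (simp_all add: free_act_one mult.assoc free_act_letter_mult distrib_right
      free_act_add_left free_act_const_left)

lemma free_act_add: "free_act a (p + q) = free_act a p + free_act a q"
  by (induction a rule: free_alg_induct)
    (simp_all add: free_act_one free_act_letter_mult lie_op_add
      free_act_add_left free_act_const_left algebra_simps)

lemma free_act_const: "free_act a (const c * p) = const c * free_act a p"
  by (induction a rule: free_alg_induct)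
    (simp_all add: free_act_one free_act_letter_mult lie_op_const
      free_act_add_left free_act_const_left distrib_left const_left_commute[of _ c])

lemma free_act_diff_left: "free_act (a - b) p = free_act a p - free_act b p"
  using free_act_add_left[of "a - b" b p] by simp

lemma free_act_diff: "free_act a (p - q) = free_act a p - free_act a q"
  using free_act_add[of a "p - q" q] by simp

lemma free_act_ideal_right: "p \<in> g.J \<Longrightarrow> free_act a p \<in> g.J"
  by (induction a rule: free_alg_induct)
    (auto simp: free_act_one free_act_letter_mult free_act_add_left free_act_const_left
      intro: lie_op_ideal UEA_ideal_add UEA_ideal_lmult)

text \<open>The relations act into the ideal by linearity and \<open>lie_op_commutator\<close>.
  \<open>p\<close> is generalized because in a right multiple \<open>a * b\<close> the factor
  \<open>a\<close> acts on \<open>free_act b p\<close>; left multiples use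
  \<open>free_act_ideal_right\<close>.\<close>

lemma free_act_ideal_left: "a \<in> h.J \<Longrightarrow> free_act a p \<in> g.J"
proof (induction a arbitrary: p rule: UEA_ideal_induct)
  case (bracket_rel x y)
  then show ?case
    using lie_op_commutator
    by (simp add: free_act_diff_left free_act_mult free_act_letter)
qed (auto simp: free_act_diff_left free_act_add_left free_act_mult free_act_of_const
    free_act_letter free_act_0_left lie_op_add_left lie_op_scale_left
    intro: UEA_ideal_add free_act_ideal_right)

section \<open>Descent to the enveloping algebras\<close>

abbreviation "cl \<equiv> UEA_class scale bracket"
abbreviation "clR \<equiv> UEA_class scaleR bracketR"

text \<open>Representatives are chosen arbitrarily; \<open>uea_act_class\<close> shows that the
  resulting class does not depend on them.\<close>

definition uea_act :: "('k, 'h) free_alg set \<Rightarrow> ('k, 'g) free_alg set \<Rightarrow> ('k, 'g) free_alg set"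
  where "uea_act S T = cl (free_act (SOME a. clR a = S) (SOME p. cl p = T))"

lemma uea_act_class: "uea_act (clR a) (cl p) = cl (free_act a p)"
proof -
  define a' p' where "a' = (SOME a'. clR a' = clR a)" and "p' = (SOME p'. cl p' = cl p)"
  have "clR a' = clR a" "cl p' = cl p"
    unfolding a'_def p'_def by (rule someI, rule refl)+
  then have "a' - a \<in> h.J" "p' - p \<in> g.J"
    by (simp_all add: UEA_class_eq_iff)
  \<comment> \<open>The change of both representatives is split into one change at a time.\<close>
  then have "free_act (a' - a) p' + free_act a (p' - p) \<in> g.J"
    by (intro UEA_ideal_add free_act_ideal_left free_act_ideal_right)
  then have "free_act a' p' - free_act a p \<in> g.J"
    by (simp add: free_act_diff_left free_act_diff)
  then have "cl (free_act a' p') = cl (free_act a p)"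
    by (simp add: UEA_class_eq_iff)
  then show ?thesis
    by (simp only: uea_act_def a'_def p'_def)
qed

lemma left_action_uea_act: "left_action (UEA scaleR bracketR) (UEA scale bracket) uea_act"
  unfolding left_action_def
  by (auto simp: carrier_UEA UEA_add UEA_smult UEA_mult UEA_one uea_act_class free_act_add
      free_act_add_left free_act_const free_act_of_const free_act_mult free_act_one)

lemma uea_act_X:
  assumes "\<mu> \<in> N" "x \<in> carrier (UEA scale bracket)"
  shows "uea_act (UEA_of scaleR bracketR (XR \<mu>)) x =
    UEA_of scale bracket (X \<mu>) \<otimes>\<^bsub>UEA scale bracket\<^esub> x"
  using assms
  by (auto simp: carrier_UEA UEA_of_def uea_act_class free_act_letter lie_op_X UEA_mult)

lemma uea_act_T_one:
  assumes "\<mu> \<in> N" "\<nu> \<in> N"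
  shows "uea_act (UEA_of scaleR bracketR (Tinv \<mu> \<nu>)) \<one>\<^bsub>UEA scale bracket\<^esub> =
    (if \<mu> = \<nu> then \<one>\<^bsub>UEA scale bracket\<^esub> else \<zero>\<^bsub>UEA scale bracket\<^esub>)"
  using assms
  by (simp add: UEA_one UEA_zero UEA_of_def uea_act_class free_act_letter lie_op_T g.twist_1)

text \<open>Transposing indices in \<open>twist_mult\<close>: row \<nu>, column \<alpha> belongs to
  T_{\<alpha>\<nu>}, and row \<alpha>, column \<mu> to T_{\<mu>\<alpha>}.\<close>

lemma uea_act_T_mult:
  assumes "\<mu> \<in> N" "\<nu> \<in> N" "x \<in> carrier (UEA scale bracket)" "y \<in> carrier (UEA scale bracket)"
  shows "uea_act (UEA_of scaleR bracketR (Tinv \<mu> \<nu>)) (x \<otimes>\<^bsub>UEA scale bracket\<^esub> y) =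
    (\<Oplus>\<^bsub>UEA scale bracket\<^esub>\<alpha>\<in>N. uea_act (UEA_of scaleR bracketR (Tinv \<alpha> \<nu>)) x
      \<otimes>\<^bsub>UEA scale bracket\<^esub> uea_act (UEA_of scaleR bracketR (Tinv \<mu> \<alpha>)) y)"
proof -
  interpret U: ring "UEA scale bracket" by (rule ring_UEA)
  obtain p q where pq: "x = cl p" "y = cl q"
    using assms by (auto simp: carrier_UEA)
  have "(\<Oplus>\<^bsub>UEA scale bracket\<^esub>\<alpha>\<in>N. uea_act (UEA_of scaleR bracketR (Tinv \<alpha> \<nu>)) x
      \<otimes>\<^bsub>UEA scale bracket\<^esub> uea_act (UEA_of scaleR bracketR (Tinv \<mu> \<alpha>)) y) =
    (\<Oplus>\<^bsub>UEA scale bracket\<^esub>\<alpha>\<in>N. cl (g.twist p \<nu> \<alpha> * g.twist q \<alpha> \<mu>))"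
    using assms(1,2)
    by (intro U.finsum_cong')
      (auto simp: carrier_UEA pq UEA_of_def uea_act_class free_act_letter lie_op_T UEA_mult)
  then show ?thesis
    using assms(1,2)
    by (simp add: pq UEA_of_def UEA_mult uea_act_class free_act_letter lie_op_T g.twist_mult
        UEA_finsum g.finite_basis)
qed

end

section \<open>Specialization to the given bases and structure constants\<close>

theorem theorem2:
  fixes scale :: "'k::real_normed_field \<Rightarrow> 'g::ab_group_add \<Rightarrow> 'g"
    and bracket :: "'g \<Rightarrow> 'g \<Rightarrow> 'g"
    and n :: nat
    and X :: "nat \<Rightarrow> 'g"
    and C :: "nat \<Rightarrow> nat \<Rightarrow> nat \<Rightarrow> 'k"
    and scaleR :: "'k \<Rightarrow> 'h::ab_group_add \<Rightarrow> 'h"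
    and bracketR :: "'h \<Rightarrow> 'h \<Rightarrow> 'h"
    and XR :: "nat \<Rightarrow> 'h"
    and Tinv :: "nat \<Rightarrow> nat \<Rightarrow> 'h"
  assumes "lie_algebra scale bracket"
    and "vector_space.basis_family scale {1..n} X"
    and "\<forall>\<mu>\<in>{1..n}. \<forall>\<nu>\<in>{1..n}.
      bracket (X \<mu>) (X \<nu>) = (\<Sum>\<alpha>=1..n. scale (C \<mu> \<nu> \<alpha>) (X \<alpha>))"
    and "lie_algebra scaleR bracketR"
    and "vector_space.basis_family scaleR (Inl ` {1..n} \<union> Inr ` ({1..n} \<times> {1..n}))
      (case_sum XR (\<lambda>(\<mu>, \<nu>). Tinv \<mu> \<nu>))"
    and "\<forall>\<mu>\<in>{1..n}. \<forall>\<nu>\<in>{1..n}.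
      bracketR (XR \<mu>) (XR \<nu>) = (\<Sum>\<alpha>=1..n. scaleR (C \<mu> \<nu> \<alpha>) (XR \<alpha>))"
    and "\<forall>\<alpha>\<in>{1..n}. \<forall>\<beta>\<in>{1..n}. \<forall>\<mu>\<in>{1..n}. \<forall>\<nu>\<in>{1..n}.
      bracketR (Tinv \<alpha> \<beta>) (Tinv \<mu> \<nu>) = 0"
    and "\<forall>\<mu>\<in>{1..n}. \<forall>\<nu>\<in>{1..n}. \<forall>\<kappa>\<in>{1..n}.
      bracketR (Tinv \<mu> \<nu>) (XR \<kappa>) = (\<Sum>\<alpha>=1..n. scaleR (C \<kappa> \<alpha> \<nu>) (Tinv \<mu> \<alpha>))"
  defines "U \<equiv> UEA scale bracket"
    and "UR \<equiv> UEA scaleR bracketR"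
    and "\<iota> \<equiv> UEA_of scale bracket"
    and "\<iota>R \<equiv> UEA_of scaleR bracketR"
  shows "\<exists>act. left_action UR U act \<and>
    (\<forall>x\<in>carrier U. act \<one>\<^bsub>UR\<^esub> x = x) \<and>
    (\<forall>\<mu>\<in>{1..n}. \<forall>x\<in>carrier U. act (\<iota>R (XR \<mu>)) x = \<iota> (X \<mu>) \<otimes>\<^bsub>U\<^esub> x) \<and>
    (\<forall>\<mu>\<in>{1..n}. \<forall>\<nu>\<in>{1..n}.
      act (\<iota>R (Tinv \<mu> \<nu>)) \<one>\<^bsub>U\<^esub> = (if \<mu> = \<nu> then \<one>\<^bsub>U\<^esub> else \<zero>\<^bsub>U\<^esub>)) \<and>
    (\<forall>\<mu>\<in>{1..n}. \<forall>\<nu>\<in>{1..n}. \<forall>x\<in>carrier U. \<forall>y\<in>carrier U.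
      act (\<iota>R (Tinv \<mu> \<nu>)) (x \<otimes>\<^bsub>U\<^esub> y) =
        (\<Oplus>\<^bsub>U\<^esub>\<alpha>\<in>{1..n}. act (\<iota>R (Tinv \<alpha> \<nu>)) x \<otimes>\<^bsub>U\<^esub> act (\<iota>R (Tinv \<mu> \<alpha>)) y))"
  proof -
  let ?N = "{1..n}"
  let ?b = "case_sum XR (\<lambda>(\<mu>, \<nu>). Tinv \<mu> \<nu>)" and ?I = "Inl ` ?N \<union> Inr ` (?N \<times> ?N)"
  interpret g: lie_algebra scale bracket by fact
  interpret h: lie_algebra scaleR bracketR by fact
  obtain co where co: "\<And>u v i. co (u + v) i = co u i + co v i"
    "\<And>c v i. co (scale c v) i = c * co v i"
    "\<And>i j. i \<in> ?N \<Longrightarrow> j \<in> ?N \<Longrightarrow> co (X j) i = (if i = j then 1 else 0)"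
    "\<And>v. v = (\<Sum>i\<in>?N. scale (co v i) (X i))"
    by (rule g.basis_family_coordinates[OF _ assms(2)]) auto
  obtain coR where coR: "\<And>u v i. coR (u + v) i = coR u i + coR v i"
    "\<And>c v i. coR (scaleR c v) i = c * coR v i"
    "\<And>i j. i \<in> ?I \<Longrightarrow> j \<in> ?I \<Longrightarrow> coR (?b j) i = (if i = j then 1 else 0)"
    "\<And>v. v = (\<Sum>i\<in>?I. scaleR (coR v i) (?b i))"
    by (rule h.basis_family_coordinates[OF _ assms(5)]) auto
  interpret g: lie_basis scale bracket ?N X co
    by unfold_locales (use co in auto)
  interpret h: lie_basis scaleR bracketR ?I ?b coR
    by unfold_locales (fact coR | simp)+
  \<comment> \<open>As \<open>co\<close> is dual to the basis, the given bracket expansion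
    identifies the adjoint matrix entries with the structure constants; the assumed relations
    thereby take the form of the locale.\<close>
  have ad: "g.ad_mat (X \<mu>) \<alpha> \<nu> = C \<mu> \<nu> \<alpha>" if "\<mu> \<in> ?N" "\<nu> \<in> ?N" "\<alpha> \<in> ?N" for \<mu> \<nu> \<alpha>
  proof -
    have "g.ad_mat (X \<mu>) \<alpha> \<nu> = (\<Sum>\<beta>\<in>?N. C \<mu> \<nu> \<beta> * co (X \<beta>) \<alpha>)"
      using assms(3) that by (simp add: g.ad_mat_def g.co_sum co(2))
    also have "\<dots> = (\<Sum>\<beta>\<in>?N. if \<alpha> = \<beta> then C \<mu> \<nu> \<alpha> else 0)"
      using that by (intro sum.cong) (auto simp: co(3))
    finally show ?thesis using that by simp
  qed
  interpret extended_lie_basis scale bracket ?N X co scaleR bracketR XR Tinv coR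
    by unfold_locales (use assms(6-8) in \<open>auto simp: ad intro!: sum.cong\<close>)
  show ?thesis
    unfolding U_def UR_def \<iota>_def \<iota>R_def
    using left_action_uea_act uea_act_X uea_act_T_one uea_act_T_mult
    by (intro exI[of _ uea_act]) (auto simp: left_action_def)
qed

end
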